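(* For every infinite sequence of rational interval forecasts $\iota\in\mathcal{I}_r^{\mathbb{N}}$ there is at least one path $\omega\in\{0,1\}^{\mathbb{N}}$ such that the prequential path $(\iota,\omega)\in(\mathcal{I}_r\times\{0,1\})^{\mathbb{N}}$ is game-random.
   Context: Let $\mathcal{X}=\{0,1\}$, $\mathbb{N}=\{1,2,\dots\}$ and $\mathbb{N}_0=\mathbb{N}\cup\{0\}$. An interval forecast is a non-empty closed interval $I\subseteq[0,1]$ (possibly a single point); $\mathcal{I}_r$ is the set of all interval forecasts with rational endpoints. For an interval forecast $I$ and $f\colon\mathcal{X}\to\mathbb{R}$, the upper expectation is $\overline{E}_I(f)=\max_{p\in I}[pf(1)+(1-p)f(0)]$. Prequential situations are the elements $v=(I_1,x_1,\dots,I_n,x_n)$ of $(\mathcal{I}_r\times\mathcal{X})^*=\bigcup_{k\in\mathbb{N}_0}(\mathcal{I}_r\times\mathcal{X})^k$, with the empty one denoted $\square$; $vI_rx$ is the concatenation of $v$ with $I_r\in\mathcal{I}_r$ and $x\in\mathcal{X}$. A prequential path is $\upsilon=(I_1,x_1,I_2,x_2,\dots)\in(\mathcal{I}_r\times\mathcal{X})^{\mathbb{N}}$, identified with the pair $(\iota,\omega)$ where $\iota=(I_1,I_2,\dots)$ and $\omega=(x_1,x_2,\dots)$; $\upsilon_{1:n}=(I_1,x_1,\dots,I_n,x_n)$. It is non-degenerate if $\iota_n\neq\{1-\omega_n\}$ for all $n\in\mathbb{N}$. A test superfarthingale is a map $F\colon(\mathcal{I}_r\times\mathcal{X})^*\to\mathbb{R}$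 with $F\geq0$, $F(\square)=1$ and $\overline{E}_{I_r}(F(vI_r\,\cdot))\leq F(v)$ for all prequential situations $v$ and all $I_r\in\mathcal{I}_r$, where $F(vI_r\,\cdot)$ is the map $x\mapsto F(vI_rx)$. A map $r\colon\mathcal{D}\to\mathbb{R}$ on a countable encoded set $\mathcal{D}$ is lower semicomputable if there is a recursive (Turing-computable, via encodings) map $q\colon\mathcal{D}\times\mathbb{N}_0\to\mathbb{Q}$ with $q(d,n)\leq q(d,n+1)$ and $\lim_{m\to\infty}q(d,m)=r(d)$ for all $d,n$. A prequential path $\upsilon$ is game-random if it is non-degenerate and all lower semicomputable test superfarthingales $F$ satisfy $\limsup_{n\to\infty}F(\upsilon_{1:n})<\infty$. *)

theory Defs
  imports "HOL-Analysis.Analysis" "HOL-Library.Nat_Bijection"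
begin

section \<open>Turing computability\<close>

text \<open>
  Deterministic single-tape machines with a two-way infinite tape. States and tape symbols are
  natural numbers, 0 is the start state as well as the blank. A program is a finite transition
  table (read through \<^const>\<open>map_of\<close>), so only finitely many states and symbols
  matter. A machine halts when no transition applies.
\<close>

datatype head_move = Left_Move | No_Move | Right_Move

type_synonym turing_machine = "((nat \<times> nat) \<times> (nat \<times> nat \<times> head_move)) list"

type_synonym tm_config = "nat \<times> (int \<Rightarrow> nat) \<times> int"

fun move_head :: "head_move \<Rightarrow> int \<Rightarrow> int" where
  "move_head Left_Move h = h - 1"
| "move_head No_Move h = h"
| "move_head Right_Move h = h + 1"

fun tm_step :: "turing_machine \<Rightarrow> tm_config \<Rightarrow> tm_config option" where
  "tm_step M (s, t, h) =
     (case map_of M (s, t h) of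
        None \<Rightarrow> None
      | Some (s', a, d) \<Rightarrow> Some (s', t(h := a), move_head d h))"

definition unary_tape :: "nat \<Rightarrow> int \<Rightarrow> nat" where
  "unary_tape n = (\<lambda>i. if 0 \<le> i \<and> i < int n then 1 else 0)"

definition tm_computes :: "turing_machine \<Rightarrow> nat \<Rightarrow> nat \<Rightarrow> bool" where
  "tm_computes M m n \<longleftrightarrow>
     (\<exists>s. rtranclp (\<lambda>c c'. tm_step M c = Some c') (0, unary_tape m, 0) (s, unary_tape n, 0)
        \<and> tm_step M (s, unary_tape n, 0) = None)"

text \<open>
  A total map between sets that are encoded by natural numbers is recursive if a single machine
  computes it on codes; inputs that are not codes are unconstrained.
\<close>

definition recursive_map :: "('a \<Rightarrow> nat) \<Rightarrow> ('b \<Rightarrow> nat) \<Rightarrow> ('a \<Rightarrow> 'b) \<Rightarrow> bool" where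
  "recursive_map encA encB f \<longleftrightarrow> (\<exists>M. \<forall>x. tm_computes M (encA x) (encB (f x)))"

definition rat_code :: "rat \<Rightarrow> nat" where
  "rat_code r = (case quotient_of r of (a, b) \<Rightarrow> prod_encode (int_encode a, nat b))"

definition lower_semicomputable :: "('d \<Rightarrow> nat) \<Rightarrow> ('d \<Rightarrow> real) \<Rightarrow> bool" where
  "lower_semicomputable enc r \<longleftrightarrow>
     (\<exists>q :: 'd \<times> nat \<Rightarrow> rat.
        recursive_map (\<lambda>(d, n). prod_encode (enc d, n)) rat_code q
        \<and> (\<forall>d n. q (d, n) \<le> q (d, Suc n))
        \<and> (\<forall>d. (\<lambda>m. real_of_rat (q (d, m))) \<longlonglongrightarrow> r d))"


section \<open>Interval forecasts and prequential situations\<close>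

text \<open>Outcomes are Booleans: \<^const>\<open>True\<close> is 1 and \<^const>\<open>False\<close> is 0.\<close>

definition upper_expectation :: "real set \<Rightarrow> (bool \<Rightarrow> real) \<Rightarrow> real" where
  "upper_expectation I f = (SUP p\<in>I. p * f True + (1 - p) * f False)"

text \<open>For interval forecasts the supremum is a maximum.\<close>

lemma upper_expectation_is_max:
  assumes "I \<noteq> {}" "closed I" "I \<subseteq> {0..1}"
  shows "\<exists>p\<in>I. upper_expectation I f = p * f True + (1 - p) * f False
           \<and> (\<forall>p'\<in>I. p' * f True + (1 - p') * f False \<le> p * f True + (1 - p) * f False)"
proof -
  have "compact I"
    using assms by (meson bounded_closed_interval bounded_subset compact_eq_bounded_closed)
  moreover have "continuous_on I (\<lambda>p. p * f True + (1 - p) * f False)"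
    by (intro continuous_intros)
  ultimately obtain p where p: "p \<in> I"
    "\<forall>p'\<in>I. p' * f True + (1 - p') * f False \<le> p * f True + (1 - p) * f False"
    using continuous_attains_sup assms(1) by blast
  have "upper_expectation I f = p * f True + (1 - p) * f False"
    unfolding upper_expectation_def using p by (intro cSup_eq_maximum) auto
  then show ?thesis using p by blast
qed

typedef rational_forecast =
  "{I :: real set. \<exists>a b :: rat. 0 \<le> a \<and> a \<le> b \<and> b \<le> 1 \<and> I = {of_rat a..of_rat b}}"
  morphisms interval_of Abs_rational_forecast
proof
  show "{of_rat 0..of_rat 1} \<in> {I :: real set. \<exists>a b :: rat. 0 \<le> a \<and> a \<le> b \<and> b \<le> 1 \<and> I = {of_rat a..of_rat b}}"
    by (intro CollectI exI[of _ "0::rat"] exI[of _ "1::rat"]) simp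
qed

type_synonym situation = "(rational_forecast \<times> bool) list"

text \<open>
  A path is indexed from 0, so position \<open>n\<close> holds the forecast and outcome usually
  numbered \<open>n + 1\<close>.
\<close>

type_synonym prequential_path = "nat \<Rightarrow> rational_forecast \<times> bool"

definition initial_segment :: "prequential_path \<Rightarrow> nat \<Rightarrow> situation" where
  "initial_segment \<upsilon> n = map \<upsilon> [0..<n]"

text \<open>
  A forecast is coded by its pair of endpoints; the inverse of \<^const>\<open>of_rat\<close> turns
  these (rational) reals back into elements of \<^typ>\<open>rat\<close>.
\<close>

definition forecast_code :: "rational_forecast \<Rightarrow> nat" where
  "forecast_code I = prod_encode
     (rat_code (inv (of_rat :: rat \<Rightarrow> real) (Inf (interval_of I))),
      rat_code (inv (of_rat :: rat \<Rightarrow> real) (Sup (interval_of I))))"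

definition situation_code :: "situation \<Rightarrow> nat" where
  "situation_code v = list_encode (map (\<lambda>(I, x). prod_encode (forecast_code I, of_bool x)) v)"


section \<open>Game-randomness\<close>

definition test_superfarthingale :: "(situation \<Rightarrow> real) \<Rightarrow> bool" where
  "test_superfarthingale F \<longleftrightarrow>
     (\<forall>v. F v \<ge> 0) \<and> F [] = 1
     \<and> (\<forall>v I. upper_expectation (interval_of I) (\<lambda>x. F (v @ [(I, x)])) \<le> F v)"

definition non_degenerate :: "prequential_path \<Rightarrow> bool" where
  "non_degenerate \<upsilon> \<longleftrightarrow> (\<forall>n. interval_of (fst (\<upsilon> n)) \<noteq> {1 - of_bool (snd (\<upsilon> n))})"

definition game_random :: "prequential_path \<Rightarrow> bool" where
  "game_random \<upsilon> \<longleftrightarrow> non_degenerate \<upsilon>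
     \<and> (\<forall>F. test_superfarthingale F \<and> lower_semicomputable situation_code F \<longrightarrow>
            limsup (\<lambda>n. ereal (F (initial_segment \<upsilon> n))) < \<infinity>)"

end

theory Submission
  imports Defs
begin

text \<open>
  Only countably many machines exist, so there are only countably many lower semicomputable test
  superfarthingales \<open>F k\<close>. The mixture \<open>\<Sum>k. (1/2)^(k+1) * F k v\<close> starts
  at 1, and at every forecast \<open>I\<close> some outcome not excluded by \<open>I\<close> does not
  increase it: pick \<open>p \<in> I\<close> and note that the \<open>p\<close>-average of the two possible
  next values is at most the current value. Following such outcomes bounds \<open>F k\<close> by
  \<open>2^(k+1)\<close> along the path.
\<close>

text \<open>Through the instances for \<open>nat\<close>, products and lists, this makes
  \<open>turing_machine\<close> a countable type.\<close>

instance head_move :: countable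
proof
  show "\<exists>f :: head_move \<Rightarrow> nat. inj f"
    by (rule exI[of _ "case_head_move 0 1 2"]) (auto intro!: injI split: head_move.splits)
qed

text \<open>If the first run starts with a step, the second cannot be empty, because its end is
  final; determinism then forces the same first step, and the induction continues from
  there.\<close>

lemma deterministic_rtranclp_final_unique:
  assumes "r\<^sup>*\<^sup>* x y" "r\<^sup>*\<^sup>* x z"
    and det: "\<And>a b c. r a b \<Longrightarrow> r a c \<Longrightarrow> b = c"
    and "\<And>a. \<not> r y a" "\<And>a. \<not> r z a"
  shows "y = z"
  using assms(1,2,4,5)
proof (induction rule: converse_rtranclp_induct)
  case base
  then show ?case by (metis converse_rtranclpE)
next
  case (step a b)
  then show ?case by (metis converse_rtranclpE det)
qed

lemma inj_unary_tape: "inj unary_tape"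
proof (rule injI)
  fix m n assume eq: "unary_tape m = unary_tape n"
  \<comment> \<open>If the lengths differ, this cell is blank on the tape of the smaller number and
    marked on the other.\<close>
  have "unary_tape m (int (min m n)) = unary_tape n (int (min m n))"
    by (simp add: eq)
  then show "m = n"
    by (auto simp: unary_tape_def min_def split: if_splits)
qed

lemma tm_computes_unique:
  assumes "tm_computes M m n" "tm_computes M m n'"
  shows "n = n'"
proof -
  let ?r = "\<lambda>c c'. tm_step M c = Some c'"
  obtain s s' where
    runs: "?r\<^sup>*\<^sup>* (0, unary_tape m, 0) (s, unary_tape n, 0)"
      "?r\<^sup>*\<^sup>* (0, unary_tape m, 0) (s', unary_tape n', 0)"
    and halt: "tm_step M (s, unary_tape n, 0) = None" "tm_step M (s', unary_tape n', 0) = None"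
    using assms unfolding tm_computes_def by blast
  have "(s, unary_tape n, 0 :: int) = (s', unary_tape n', 0)"
    by (rule deterministic_rtranclp_final_unique[OF runs]) (simp_all only: halt option.simps not_False_eq_True)
  then show ?thesis
    using inj_unary_tape by (auto dest: injD)
qed

lemma inj_rat_code: "inj rat_code"
proof (rule injI)
  fix r s assume eq: "rat_code r = rat_code s"
  obtain a b c d where q: "quotient_of r = (a, b)" "quotient_of s = (c, d)"
    by (metis surj_pair)
  \<comment> \<open>On positive denominators the coercion \<open>nat\<close> loses nothing.\<close>
  then have "b > 0" "d > 0"
    using quotient_of_denom_pos by blast+
  with eq q have "quotient_of r = quotient_of s"
    by (simp add: rat_code_def int_encode_eq eq_nat_nat_iff)
  then show "r = s"
    using quotient_of_inject by blast
qed

text \<open>A machine determines its output codes, hence the map, so choosing a machine for each map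
  is injective into a countable type.\<close>

lemma countable_recursive_map:
  assumes "inj encB"
  shows "countable {f. recursive_map encA encB f}"
proof -
  have "\<forall>f\<in>{f. recursive_map encA encB f}. \<exists>M. \<forall>x. tm_computes M (encA x) (encB (f x))"
    by (simp add: recursive_map_def)
  then obtain M where M:
    "\<And>f x. recursive_map encA encB f \<Longrightarrow> tm_computes (M f) (encA x) (encB (f x))"
    by (metis mem_Collect_eq)
  have "inj_on M {f. recursive_map encA encB f}"
  proof (intro inj_onI ext)
    fix f g x
    assume "f \<in> {f. recursive_map encA encB f}" "g \<in> {f. recursive_map encA encB f}" "M f = M g"
    then have "encB (f x) = encB (g x)"
      using M tm_computes_unique by (metis mem_Collect_eq)
    then show "f x = g x"
      using assms by (simp add: inj_eq)
  qed
  then show ?thesis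
    by (rule countableI')
qed

text \<open>Each such function is the pointwise limit of a recursive \<open>q\<close>, so taking
  limits maps a countable set onto a superset.\<close>

lemma countable_lower_semicomputable:
  "countable {r. lower_semicomputable enc r}"
proof -
  let ?Q = "{q. recursive_map (\<lambda>(d, n). prod_encode (enc d, n)) rat_code q}"
  have "{r. lower_semicomputable enc r} \<subseteq> (\<lambda>q d. lim (\<lambda>m. real_of_rat (q (d, m)))) ` ?Q"
  proof
    fix r assume "r \<in> {r. lower_semicomputable enc r}"
    then obtain q where q: "q \<in> ?Q" "\<And>d. (\<lambda>m. real_of_rat (q (d, m))) \<longlonglongrightarrow> r d"
      unfolding lower_semicomputable_def by blast
    then have "r = (\<lambda>d. lim (\<lambda>m. real_of_rat (q (d, m))))"
      by (intro ext limI[symmetric])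
    with q show "r \<in> (\<lambda>q d. lim (\<lambda>m. real_of_rat (q (d, m)))) ` ?Q"
      by blast
  qed
  then show ?thesis
    using countable_recursive_map[OF inj_rat_code] by (blast intro: countable_subset)
qed

lemma interval_of_forecast:
  "interval_of I \<noteq> {}" "closed (interval_of I)" "interval_of I \<subseteq> {0..1}"
proof -
  obtain a b :: rat where ab: "0 \<le> a" "a \<le> b" "b \<le> 1" "interval_of I = {of_rat a..of_rat b}"
    using interval_of[of I] by auto
  then have "(0::real) \<le> of_rat a" "of_rat a \<le> (of_rat b :: real)" "of_rat b \<le> (1::real)"
    by (simp_all add: of_rat_less_eq)
  then show "interval_of I \<noteq> {}" "closed (interval_of I)" "interval_of I \<subseteq> {0..1}"
    using ab by auto
qed

lemma test_superfarthingale_nonneg: "test_superfarthingale F \<Longrightarrow> 0 \<le> F v"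
  by (simp add: test_superfarthingale_def)

text \<open>Fixing one \<open>p\<close> replaces the upper expectation by an expression linear in
  \<open>F\<close>, which can be summed over many superfarthingales.\<close>

lemma test_superfarthingale_average_le:
  assumes "test_superfarthingale F" "p \<in> interval_of I"
  shows "p * F (v @ [(I, True)]) + (1 - p) * F (v @ [(I, False)]) \<le> F v"
proof -
  let ?f = "\<lambda>x. F (v @ [(I, x)])"
  have "p * ?f True + (1 - p) * ?f False \<le> upper_expectation (interval_of I) ?f"
    using upper_expectation_is_max[OF interval_of_forecast, of I ?f] assms(2) by auto
  also have "\<dots> \<le> F v"
    using assms(1) by (simp add: test_superfarthingale_def)
  finally show ?thesis .
qed

text \<open>A single \<open>p\<close> in the forecast serves all \<open>k\<close> at once. If both
  outcomes increased the mixture, so would their \<open>p\<close>-average, against the summed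
  inequalities.\<close>

lemma mixture_outcome_exists:
  fixes F :: "nat \<Rightarrow> situation \<Rightarrow> real" and w :: "nat \<Rightarrow> real"
  assumes F: "\<And>k. test_superfarthingale (F k)" and w: "\<And>k. 0 \<le> w k"
    and summable: "summable (\<lambda>k. w k * F k v)"
  shows "\<exists>x. interval_of I \<noteq> {1 - of_bool x} \<and> summable (\<lambda>k. w k * F k (v @ [(I, x)])) \<and>
    (\<Sum>k. w k * F k (v @ [(I, x)])) \<le> (\<Sum>k. w k * F k v)"
proof -
  obtain p where p: "p \<in> interval_of I"
    using interval_of_forecast by blast
  then have p01: "0 \<le> p" "p \<le> 1"
    using interval_of_forecast(3)[of I] by auto
  define f where "f x k = w k * F k (v @ [(I, x)])" for x k
  have nonneg: "0 \<le> f x k" for x k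
    using F w by (simp add: f_def test_superfarthingale_nonneg)
  have avg: "p * f True k + (1 - p) * f False k \<le> w k * F k v" for k
    using mult_left_mono[OF test_superfarthingale_average_le[OF F p] w, of k k v]
    by (simp add: f_def algebra_simps)
  \<comment> \<open>Dividing the average inequality by \<open>p\<close> gives the dominating series;
    an outcome of probability 0 gets no such bound.\<close>
  have sum_True: "summable (f True)" if "p > 0"
  proof (rule summable_comparison_test')
    show "summable (\<lambda>k. w k * F k v / p)"
      using summable by (rule summable_divide)
    show "norm (f True k) \<le> w k * F k v / p" if "k \<ge> 0" for k
    proof -
      have "0 \<le> (1 - p) * f False k"
        using nonneg p01 by simp
      then have "p * f True k \<le> w k * F k v"
        using avg[of k] by linarith
      then show ?thesis
        using nonneg \<open>p > 0\<close> by (simp add: pos_le_divide_eq mult.commute)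
    qed
  qed
  have sum_False: "summable (f False)" if "p < 1"
  proof (rule summable_comparison_test')
    show "summable (\<lambda>k. w k * F k v / (1 - p))"
      using summable by (rule summable_divide)
    show "norm (f False k) \<le> w k * F k v / (1 - p)" if "k \<ge> 0" for k
    proof -
      have "0 \<le> p * f True k"
        using nonneg p01 by simp
      then have "(1 - p) * f False k \<le> w k * F k v"
        using avg[of k] by linarith
      then show ?thesis
        using nonneg \<open>p < 1\<close> by (simp add: pos_le_divide_eq mult.commute)
    qed
  qed
  \<comment> \<open>At an endpoint only the outcome that is certain under \<open>p\<close> is
    controlled, and it is the one chosen.\<close>
  consider "p = 0" | "p = 1" | "0 < p" "p < 1"
    using p01 by linarith
  then have "\<exists>x. p \<noteq> 1 - of_bool x \<and> summable (f x) \<and> suminf (f x) \<le> (\<Sum>k. w k * F k v)"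
  proof cases
    case 1
    then have "suminf (f False) \<le> (\<Sum>k. w k * F k v)"
      using sum_False summable avg by (intro suminf_le) auto
    then show ?thesis
      using sum_False 1 by (intro exI[of _ False]) simp
  next
    case 2
    then have "suminf (f True) \<le> (\<Sum>k. w k * F k v)"
      using sum_True summable avg by (intro suminf_le) auto
    then show ?thesis
      using sum_True 2 by (intro exI[of _ True]) simp
  next
    case 3
    note s = sum_True[OF 3(1)] sum_False[OF 3(2)]
    have "p * suminf (f True) + (1 - p) * suminf (f False)
        = (\<Sum>k. p * f True k + (1 - p) * f False k)"
      using s by (simp add: suminf_mult suminf_add[symmetric] summable_mult)
    also have "\<dots> \<le> (\<Sum>k. w k * F k v)"
      using s summable avg by (intro suminf_le summable_add summable_mult)
    finally have le: "p * suminf (f True) + (1 - p) * suminf (f False) \<le> (\<Sum>k. w k * F k v)" .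
    have "\<exists>x. suminf (f x) \<le> (\<Sum>k. w k * F k v)"
    proof (rule ccontr)
      assume "\<not> ?thesis"
      \<comment> \<open>Signs are flipped because \<open>convex_bound_lt\<close> gives strict upper
        bounds on convex combinations.\<close>
      then have "- suminf (f x) < - (\<Sum>k. w k * F k v)" for x
        by (simp add: not_le)
      then have "p * - suminf (f True) + (1 - p) * - suminf (f False) < - (\<Sum>k. w k * F k v)"
        using 3 by (intro convex_bound_lt) auto
      with le show False
        by simp
    qed
    then obtain x where "suminf (f x) \<le> (\<Sum>k. w k * F k v)" ..
    then show ?thesis
      using s 3 by (cases x) auto
  qed
  then obtain x where x: "p \<noteq> 1 - of_bool x" "summable (f x)" "suminf (f x) \<le> (\<Sum>k. w k * F k v)"
    by blast
  have "interval_of I \<noteq> {1 - of_bool x}"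
    using p x(1) by blast
  with x(2,3) show ?thesis
    unfolding f_def[abs_def] by blast
qed

lemma bounded_path_exists:
  fixes F :: "nat \<Rightarrow> situation \<Rightarrow> real" and \<iota> :: "nat \<Rightarrow> rational_forecast"
  assumes F: "\<And>k. test_superfarthingale (F k)"
  shows "\<exists>\<omega>. non_degenerate (\<lambda>n. (\<iota> n, \<omega> n)) \<and>
    (\<forall>k n. F k (initial_segment (\<lambda>n. (\<iota> n, \<omega> n)) n) \<le> 2 ^ Suc k)"
proof -
  define w :: "nat \<Rightarrow> real" where "w k = (1/2) ^ Suc k" for k
  have w: "0 \<le> w k" for k
    by (simp add: w_def)
  \<comment> \<open>Summability belongs to the invariant, since \<open>suminf\<close> carries no
    information about a divergent series.\<close>
  define good where
    "good v \<longleftrightarrow> summable (\<lambda>k. w k * F k v) \<and> (\<Sum>k. w k * F k v) \<le> 1" for v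
  have "\<exists>x. interval_of I \<noteq> {1 - of_bool x} \<and> good (v @ [(I, x)])" if "good v" for v I
    using mixture_outcome_exists[where F = F and w = w and v = v and I = I] F w that
    unfolding good_def by fastforce
  then obtain c where c:
    "\<And>v I. good v \<Longrightarrow> interval_of I \<noteq> {1 - of_bool (c v I)} \<and> good (v @ [(I, c v I)])"
    by metis
  \<comment> \<open>The situation after \<open>n\<close> rounds of following the choice
    \<open>c\<close> along the given forecasts.\<close>
  define V where "V = rec_nat [] (\<lambda>n v. v @ [(\<iota> n, c v (\<iota> n))])"
  define \<omega> where "\<omega> n = c (V n) (\<iota> n)" for n
  have segment: "initial_segment (\<lambda>n. (\<iota> n, \<omega> n)) n = V n" for n
    by (induction n) (simp_all add: initial_segment_def V_def \<omega>_def)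
  have "F k [] = 1" for k
    using F by (simp add: test_superfarthingale_def)
  then have "good []"
    using power_half_series by (simp add: good_def w_def sums_iff)
  then have good: "good (V n)" for n
    by (induction n) (simp_all add: V_def c)
  have "F k (V n) \<le> 2 ^ Suc k" for k n
  proof -
    \<comment> \<open>All terms are nonnegative, so a single one is at most the whole mixture; the
      singleton sum fits \<open>sum_le_suminf\<close>.\<close>
    have "w k * F k (V n) = (\<Sum>j\<in>{k}. w j * F j (V n))"
      by simp
    also have "\<dots> \<le> (\<Sum>j. w j * F j (V n))"
      using good[of n] w F by (intro sum_le_suminf) (auto simp: good_def test_superfarthingale_nonneg)
    also have "\<dots> \<le> 1"
      using good[of n] by (simp add: good_def)
    finally show ?thesis
      by (simp add: w_def power_one_over field_simps)
  qed
  moreover have "non_degenerate (\<lambda>n. (\<iota> n, \<omega> n))"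
    using c good by (simp add: non_degenerate_def \<omega>_def)
  ultimately show ?thesis
    using segment by metis
qed

theorem proposition9:
  fixes \<iota> :: "nat \<Rightarrow> rational_forecast"
  shows "\<exists>\<omega> :: nat \<Rightarrow> bool. game_random (\<lambda>n. (\<iota> n, \<omega> n))"
proof -
  \<comment> \<open>The constant 1 is added only to make the set visibly non-empty.\<close>
  define S where
    "S = insert (\<lambda>_. 1) {F. test_superfarthingale F \<and> lower_semicomputable situation_code F}"
  have "countable {F. test_superfarthingale F \<and> lower_semicomputable situation_code F}"
    by (rule countable_subset[OF _ countable_lower_semicomputable[of situation_code]]) auto
  then have S: "countable S" "S \<noteq> {}"
    by (simp_all add: S_def)
  \<comment> \<open>The added constant must be a superfarthingale too, so that every function
    enumerated from \<open>S\<close> is one.\<close>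
  have "test_superfarthingale (\<lambda>_. 1)"
    using interval_of_forecast by (simp add: test_superfarthingale_def upper_expectation_def)
  then have "test_superfarthingale (from_nat_into S k)" for k
    using from_nat_into[OF S(2), of k] by (auto simp: S_def)
  then obtain \<omega> where nondeg: "non_degenerate (\<lambda>n. (\<iota> n, \<omega> n))"
    and bound: "\<And>k n. from_nat_into S k (initial_segment (\<lambda>n. (\<iota> n, \<omega> n)) n) \<le> 2 ^ Suc k"
    using bounded_path_exists[of "from_nat_into S" \<iota>] by blast
  have "limsup (\<lambda>n. ereal (F (initial_segment (\<lambda>n. (\<iota> n, \<omega> n)) n))) < \<infinity>"
    if F: "test_superfarthingale F" "lower_semicomputable situation_code F" for F
  proof -
    \<comment> \<open>The bound depends on the index of \<open>F\<close> in the enumeration but not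
      on \<open>n\<close>, so it passes to the limsup.\<close>
    obtain k where "from_nat_into S k = F"
      using from_nat_into_surj[OF S(1), of F] F by (auto simp: S_def)
    then have "limsup (\<lambda>n. ereal (F (initial_segment (\<lambda>n. (\<iota> n, \<omega> n)) n))) \<le> ereal (2 ^ Suc k)"
      using bound[of k] by (intro Limsup_bounded always_eventually) auto
    also have "\<dots> < \<infinity>"
      by simp
    finally show ?thesis .
  qed
  then show ?thesis
    using nondeg by (auto simp: game_random_def)
qed

end
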